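(* Let $R$ be a ring, $\delta$ a derivation of $R$, and $S=R[x;\delta]$ the differential polynomial ring. Put $J_0=J(S)\cap R$, where $J(S)$ is the Jacobson radical of $S$. The following five assertions are equivalent: (i) $S$ is left quasi-duo; (ii) $S$ is right quasi-duo; (iii) every left ideal of $S$ containing $J(S)$ is two-sided, i.e. $S/J(S)$ is left duo; (iv) every right ideal of $S$ containing $J(S)$ is two-sided, i.e. $S/J(S)$ is right duo; (v) the quotient ring $R/J_0$ is commutative and $\delta(R)\subseteq J_0$.
   Context: All rings are unital and associative. A derivation of $R$ is an additive map $\delta:R\to R$ with $\delta(rs)=r\delta(s)+\delta(r)s$. The differential polynomial ring $R[x;\delta]$ is, as a left $R$-module, the polynomial ring $R[x]$, with multiplication determined by $xr=rx+\delta(r)$ for $r\in R$. A ring is left (right) duo if every left (right) ideal is two-sided, and left (right) quasi-duo if every maximal left (right) ideal is two-sided. *)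

theory Defs
  imports "HOL-Algebra.Algebra"
begin

definition left_ideal :: "'a set \<Rightarrow> ('a, 'b) ring_scheme \<Rightarrow> bool" where
  "left_ideal I S \<longleftrightarrow> additive_subgroup I S \<and>
     (\<forall>s\<in>carrier S. \<forall>a\<in>I. s \<otimes>\<^bsub>S\<^esub> a \<in> I)"

definition right_ideal :: "'a set \<Rightarrow> ('a, 'b) ring_scheme \<Rightarrow> bool" where
  "right_ideal I S \<longleftrightarrow> additive_subgroup I S \<and>
     (\<forall>s\<in>carrier S. \<forall>a\<in>I. a \<otimes>\<^bsub>S\<^esub> s \<in> I)"

definition maximal_left_ideal :: "'a set \<Rightarrow> ('a, 'b) ring_scheme \<Rightarrow> bool" where
  "maximal_left_ideal I S \<longleftrightarrow> left_ideal I S \<and> I \<noteq> carrier S \<and>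
     (\<forall>K. left_ideal K S \<and> I \<subseteq> K \<longrightarrow> K = I \<or> K = carrier S)"

definition maximal_right_ideal :: "'a set \<Rightarrow> ('a, 'b) ring_scheme \<Rightarrow> bool" where
  "maximal_right_ideal I S \<longleftrightarrow> right_ideal I S \<and> I \<noteq> carrier S \<and>
     (\<forall>K. right_ideal K S \<and> I \<subseteq> K \<longrightarrow> K = I \<or> K = carrier S)"

definition jacobson :: "('a, 'b) ring_scheme \<Rightarrow> 'a set" where
  "jacobson S = {a \<in> carrier S. \<forall>I. maximal_left_ideal I S \<longrightarrow> a \<in> I}"

definition left_quasi_duo :: "('a, 'b) ring_scheme \<Rightarrow> bool" where
  "left_quasi_duo S \<longleftrightarrow> (\<forall>I. maximal_left_ideal I S \<longrightarrow> ideal I S)"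

definition right_quasi_duo :: "('a, 'b) ring_scheme \<Rightarrow> bool" where
  "right_quasi_duo S \<longleftrightarrow> (\<forall>I. maximal_right_ideal I S \<longrightarrow> ideal I S)"

definition derivation_on :: "('a, 'b) ring_scheme \<Rightarrow> 'a set \<Rightarrow> ('a \<Rightarrow> 'a) \<Rightarrow> bool" where
  "derivation_on S R \<delta> \<longleftrightarrow> (\<forall>r\<in>R. \<delta> r \<in> R) \<and>
     (\<forall>r\<in>R. \<forall>s\<in>R. \<delta> (r \<oplus>\<^bsub>S\<^esub> s) = \<delta> r \<oplus>\<^bsub>S\<^esub> \<delta> s) \<and>
     (\<forall>r\<in>R. \<forall>s\<in>R. \<delta> (r \<otimes>\<^bsub>S\<^esub> s) = r \<otimes>\<^bsub>S\<^esub> \<delta> s \<oplus>\<^bsub>S\<^esub> \<delta> r \<otimes>\<^bsub>S\<^esub> s)"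

text \<open>S is the differential polynomial ring R[x;\<delta>]: R is a (unital) subring of S,
  x \<in> S, S is a free left R-module with basis 1, x, x^2, ..., and x r = r x + \<delta>(r).\<close>
definition is_diff_poly_ring ::
  "('a, 'b) ring_scheme \<Rightarrow> 'a set \<Rightarrow> ('a \<Rightarrow> 'a) \<Rightarrow> 'a \<Rightarrow> bool" where
  "is_diff_poly_ring S R \<delta> x \<longleftrightarrow>
     ring S \<and> subring R S \<and> derivation_on S R \<delta> \<and> x \<in> carrier S \<and>
     (\<forall>r\<in>R. x \<otimes>\<^bsub>S\<^esub> r = r \<otimes>\<^bsub>S\<^esub> x \<oplus>\<^bsub>S\<^esub> \<delta> r) \<and>
     (\<forall>s\<in>carrier S. \<exists>(n::nat) f. f \<in> {..<n} \<rightarrow> R \<and>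
         s = (\<Oplus>\<^bsub>S\<^esub> i\<in>{..<n}. f i \<otimes>\<^bsub>S\<^esub> x [^]\<^bsub>S\<^esub> (i::nat))) \<and>
     (\<forall>(n::nat) f. f \<in> {..<n} \<rightarrow> R \<and>
         (\<Oplus>\<^bsub>S\<^esub> i\<in>{..<n}. f i \<otimes>\<^bsub>S\<^esub> x [^]\<^bsub>S\<^esub> (i::nat)) = \<zero>\<^bsub>S\<^esub>
         \<longrightarrow> (\<forall>i<n. f i = \<zero>\<^bsub>S\<^esub>))"

end

theory Submission
  imports Defs
begin

text \<open>
  If \<open>R\<close> is commutative and \<open>\<delta>\<close> vanishes modulo \<open>J\<^sub>0\<close>, then \<open>S/J(S)\<close> is commutative, so all
  one-sided ideals above \<open>J(S)\<close> are two-sided.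

  Conversely, let \<open>S\<close> be left or right quasi-duo. Every maximal one-sided ideal \<open>M\<close> is then a
  completely prime ideal, and \<open>P = M \<inter> R\<close> is a \<open>\<delta>\<close>-stable completely prime ideal of \<open>R\<close>. For
  \<open>a \<in> R\<close> and \<open>w \<in> R - P\<close> the element \<open>1 + (x - a)w\<close> has degree one over the domain \<open>R/P\<close>, hence it
  lies in a maximal one-sided ideal containing \<open>P\<close>. Put \<open>y = x - a\<close> and
  \<open>z = [y, b] = \<delta> b - [a, b]\<close>, and suppose \<open>z \<notin> M\<close>. Taking \<open>w = z\<close> yields \<open>M'\<close> with \<open>y = - z\<^sup>-\<^sup>1\<close>, and
  so \<open>z\<^sup>3 = [z, b]\<close>, modulo \<open>M'\<close>. Taking \<open>w = z\<^sup>2\<close> over \<open>M'\<close> yields \<open>M''\<close>, still satisfying this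
  relation, with \<open>y = - z\<^sup>-\<^sup>2\<close>; there \<open>z\<^sup>5 = [z\<^sup>2, b] = 2z\<^sup>4\<close>, so \<open>z = 2\<close> is central and
  \<open>z\<^sup>3 = 0\<close>, a contradiction. Hence \<open>\<delta> b - [a, b] \<in> J(S)\<close> for all \<open>a, b \<in> R\<close>.
\<close>

section \<open>One-sided ideals and the opposite ring\<close>

text \<open>Right-handed facts arise from left-handed ones applied in this ring. Only
  \<open>mult\<close> is replaced, so additive subgroups and negatives are literally
  unchanged.\<close>

definition opposite :: "('a, 'b) ring_scheme \<Rightarrow> ('a, 'b) ring_scheme" where
  "opposite S = S\<lparr>mult := \<lambda>a b. b \<otimes>\<^bsub>S\<^esub> a\<rparr>"

lemma opposite_simps [simp]:
  "carrier (opposite S) = carrier S"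
  "a \<otimes>\<^bsub>opposite S\<^esub> b = b \<otimes>\<^bsub>S\<^esub> a"
  "\<one>\<^bsub>opposite S\<^esub> = \<one>\<^bsub>S\<^esub>"
  "\<zero>\<^bsub>opposite S\<^esub> = \<zero>\<^bsub>S\<^esub>"
  "a \<oplus>\<^bsub>opposite S\<^esub> b = a \<oplus>\<^bsub>S\<^esub> b"
  "add (opposite S) = add S"
  "opposite (opposite S) = S"
  by (simp_all add: opposite_def)

lemma minus_opposite [simp]:
  "\<ominus>\<^bsub>opposite S\<^esub> a = \<ominus>\<^bsub>S\<^esub> a"
  "a \<ominus>\<^bsub>opposite S\<^esub> b = a \<ominus>\<^bsub>S\<^esub> b"
  by (simp_all add: a_inv_def a_minus_def)

lemma ring_opposite: "ring S \<Longrightarrow> ring (opposite S)"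
proof -
  assume "ring S"
  then interpret ring S .
  show ?thesis
  proof (rule ringI)
    show "abelian_group (opposite S)"
      by (rule abelian_groupI) (auto simp: a_ac intro: l_neg)
    show "monoid (opposite S)"
      by (rule monoidI) (auto simp: m_assoc)
  qed (auto simp: l_distr r_distr)
qed

lemma left_ideal_opposite [simp]: "left_ideal I (opposite S) = right_ideal I S"
  and right_ideal_opposite [simp]: "right_ideal I (opposite S) = left_ideal I S"
  by (simp_all add: left_ideal_def right_ideal_def additive_subgroup_def)

lemma maximal_left_ideal_opposite [simp]:
  "maximal_left_ideal I (opposite S) = maximal_right_ideal I S"
  by (simp add: maximal_left_ideal_def maximal_right_ideal_def)

context ring
begin

lemma ideal_iff_left_right: "ideal I R \<longleftrightarrow> left_ideal I R \<and> right_ideal I R"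
proof
  assume "ideal I R"
  then interpret ideal I R .
  show "left_ideal I R \<and> right_ideal I R"
    by (simp add: left_ideal_def right_ideal_def additive_subgroup_axioms I_l_closed I_r_closed)
next
  assume "left_ideal I R \<and> right_ideal I R"
  then show "ideal I R"
    by (auto simp: left_ideal_def right_ideal_def additive_subgroup_def intro!: idealI ring_axioms)
qed

lemma left_idealI:
  assumes "I \<subseteq> carrier R" "\<zero> \<in> I"
    and "\<And>a b. a \<in> I \<Longrightarrow> b \<in> I \<Longrightarrow> a \<oplus> b \<in> I"
    and "\<And>s a. s \<in> carrier R \<Longrightarrow> a \<in> I \<Longrightarrow> s \<otimes> a \<in> I"
  shows "left_ideal I R"
proof -
  \<comment> \<open>Negation is left multiplication by -1.\<close>
  have "\<ominus> a \<in> I" if "a \<in> I" for a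
    using assms(4)[of "\<ominus> \<one>" a] that assms(1) by (auto simp: l_minus)
  then have "subgroup I (add_monoid R)"
    using assms by (intro add.subgroupI) (auto simp: a_inv_def)
  then show ?thesis
    using assms by (simp add: left_ideal_def additive_subgroup_def)
qed

lemma left_idealD:
  assumes "left_ideal I R"
  shows "I \<subseteq> carrier R" "\<zero> \<in> I"
    "\<And>a b. a \<in> I \<Longrightarrow> b \<in> I \<Longrightarrow> a \<oplus> b \<in> I"
    "\<And>s a. s \<in> carrier R \<Longrightarrow> a \<in> I \<Longrightarrow> s \<otimes> a \<in> I"
    "\<And>a. a \<in> I \<Longrightarrow> \<ominus> a \<in> I"
    "\<And>a b. a \<in> I \<Longrightarrow> b \<in> I \<Longrightarrow> a \<ominus> b \<in> I"
proof -
  interpret additive_subgroup I R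
    using assms by (simp add: left_ideal_def)
  show "I \<subseteq> carrier R" "\<zero> \<in> I" "\<And>a b. a \<in> I \<Longrightarrow> b \<in> I \<Longrightarrow> a \<oplus> b \<in> I"
    by (auto simp: a_subset)
  show "\<And>s a. s \<in> carrier R \<Longrightarrow> a \<in> I \<Longrightarrow> s \<otimes> a \<in> I"
    using assms by (simp add: left_ideal_def)
  show inv: "\<ominus> a \<in> I" if "a \<in> I" for a
    using that a_subgroup by (metis a_inv_def subgroup.m_inv_closed)
  show "a \<ominus> b \<in> I" if "a \<in> I" "b \<in> I" for a b
    using that inv by (simp add: a_minus_def)
qed

lemma left_ideal_eq_carrier:
  assumes "left_ideal I R" "\<one> \<in> I"
  shows "I = carrier R"
  using left_idealD(1,4)[OF assms(1)] assms(2) by (metis r_one subsetI subset_antisym)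

text \<open>Zorn's lemma for the left ideals above \<open>I\<close> that omit 1. Omitting 1 amounts
  to being proper and clearly passes to unions of chains.\<close>

lemma exists_maximal_left_ideal:
  assumes I: "left_ideal I R" and "\<one> \<notin> I"
  shows "\<exists>M. maximal_left_ideal M R \<and> I \<subseteq> M"
proof -
  let ?A = "{K. left_ideal K R \<and> I \<subseteq> K \<and> \<one> \<notin> K}"
  have "\<Union>C \<in> ?A" if "C \<noteq> {}" and chain: "subset.chain ?A C" for C
  proof -
    have C: "left_ideal K R" "I \<subseteq> K" "\<one> \<notin> K" if "K \<in> C" for K
      using chain that by (auto simp: subset.chain_def)
    have "left_ideal (\<Union>C) R"
    proof (rule left_idealI)
      show "\<Union>C \<subseteq> carrier R" "\<zero> \<in> \<Union>C"
        using C(1) \<open>C \<noteq> {}\<close> left_idealD by blast+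
      show "a \<oplus> b \<in> \<Union>C" if ab: "a \<in> \<Union>C" "b \<in> \<Union>C" for a b
      proof -
        from ab obtain K L where KL: "K \<in> C" "L \<in> C" "a \<in> K" "b \<in> L" by blast
        then have "K \<subseteq> L \<or> L \<subseteq> K"
          using chain by (auto simp: subset.chain_def)
        then show ?thesis
          using KL C(1) left_idealD(3) by blast
      qed
      show "s \<otimes> a \<in> \<Union>C" if "s \<in> carrier R" "a \<in> \<Union>C" for s a
        using that C(1) left_idealD(4) by blast
    qed
    then show ?thesis
      using C \<open>C \<noteq> {}\<close> by blast
  qed
  then have "\<exists>M\<in>?A. \<forall>K\<in>?A. M \<subseteq> K \<longrightarrow> K = M"
    by (intro subset_Zorn_nonempty) (use assms in blast)+
  then obtain M where M: "left_ideal M R" "I \<subseteq> M" "\<one> \<notin> M"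
    and max: "\<forall>K. left_ideal K R \<and> I \<subseteq> K \<and> \<one> \<notin> K \<longrightarrow> M \<subseteq> K \<longrightarrow> K = M"
    unfolding Bex_def Ball_def mem_Collect_eq by blast
  have "K = M \<or> K = carrier R" if "left_ideal K R" "M \<subseteq> K" for K
    using max M that left_ideal_eq_carrier by blast
  then have "maximal_left_ideal M R"
    using M by (auto simp: maximal_left_ideal_def)
  then show ?thesis
    using M(2) by blast
qed

lemma maximal_left_idealD:
  assumes "maximal_left_ideal M R"
  shows "left_ideal M R" "\<one> \<notin> M"
    "\<And>K. left_ideal K R \<Longrightarrow> M \<subseteq> K \<Longrightarrow> K = M \<or> K = carrier R"
  using assms left_ideal_eq_carrier by (auto simp: maximal_left_ideal_def)

text \<open>To place \<open>I\<close> and \<open>f\<close> in a common maximal left ideal it then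
  remains to exclude equations \<open>i \<oplus> s \<otimes> f = \<one>\<close>.\<close>

lemma left_ideal_add_principal:
  assumes I: "left_ideal I R" and f: "f \<in> carrier R"
  shows "left_ideal {i \<oplus> s \<otimes> f | i s. i \<in> I \<and> s \<in> carrier R} R" (is "left_ideal ?K R")
    and "I \<subseteq> {i \<oplus> s \<otimes> f | i s. i \<in> I \<and> s \<in> carrier R}"
    and "f \<in> {i \<oplus> s \<otimes> f | i s. i \<in> I \<and> s \<in> carrier R}"
proof -
  note Id = left_idealD[OF I]
  have memI: "i \<in> carrier R" if "i \<in> I" for i using Id(1) that by blast
  have K: "i \<oplus> s \<otimes> f \<in> ?K" if "i \<in> I" "s \<in> carrier R" for i s
    using that by blast
  show "left_ideal ?K R"
  proof (rule left_idealI)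
    show "?K \<subseteq> carrier R" using memI f by auto
    show "\<zero> \<in> ?K" using K[of \<zero> \<zero>] Id(2) f by simp
    show "a \<oplus> b \<in> ?K" if "a \<in> ?K" "b \<in> ?K" for a b
    proof -
      from that obtain i s j t where *: "i \<in> I" "j \<in> I" "s \<in> carrier R" "t \<in> carrier R"
        "a = i \<oplus> s \<otimes> f" "b = j \<oplus> t \<otimes> f" by blast
      then have "a \<oplus> b = (i \<oplus> j) \<oplus> (s \<oplus> t) \<otimes> f"
        using f memI by (simp add: l_distr a_ac)
      then show ?thesis using * Id(3) K by simp
    qed
    show "t \<otimes> a \<in> ?K" if "t \<in> carrier R" "a \<in> ?K" for t a
    proof -
      from that obtain i s where *: "i \<in> I" "s \<in> carrier R" "a = i \<oplus> s \<otimes> f" by blast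
      then have "t \<otimes> a = t \<otimes> i \<oplus> (t \<otimes> s) \<otimes> f"
        using f memI that by (simp add: r_distr m_assoc)
      then show ?thesis using * Id(4) K that by simp
    qed
  qed
  show "I \<subseteq> ?K"
  proof
    fix i assume "i \<in> I"
    then show "i \<in> ?K" using K[of i \<zero>] memI f by simp
  qed
  show "f \<in> ?K" using K[of \<zero> \<one>] Id(2) f by simp
qed

section \<open>The Jacobson radical\<close>

text \<open>Otherwise the left ideal generated by 1 - ta lies in a maximal left ideal; this also
  contains \<open>a\<close>, hence 1 = (1 - ta) + ta. The description of the radical by left
  inverses prepares its left-right symmetry.\<close>

lemma jacobsonD:
  assumes "a \<in> jacobson R" "t \<in> carrier R"
  shows "a \<in> carrier R" "\<exists>u\<in>carrier R. u \<otimes> (\<one> \<ominus> t \<otimes> a) = \<one>"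
proof -
  show a: "a \<in> carrier R" using assms by (simp add: jacobson_def)
  let ?f = "\<one> \<ominus> t \<otimes> a"
  let ?K = "{i \<oplus> s \<otimes> ?f | i s. i \<in> {\<zero>} \<and> s \<in> carrier R}"
  have f: "?f \<in> carrier R" using a assms by simp
  have "left_ideal {\<zero>} R" by (rule left_idealI) auto
  note K = left_ideal_add_principal[OF this f]
  have "\<one> \<in> ?K"
  proof (rule ccontr)
    assume "\<one> \<notin> ?K"
    then obtain M where M: "maximal_left_ideal M R" "?K \<subseteq> M"
      using exists_maximal_left_ideal K(1) by blast
    note Md = left_idealD[OF maximal_left_idealD(1)[OF M(1)]]
    have "a \<in> M" using assms M(1) by (simp add: jacobson_def)
    then have "?f \<oplus> t \<otimes> a \<in> M" using Md(3,4) K(3) M(2) assms(2) by blast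
    moreover have "?f \<oplus> t \<otimes> a = \<one>" using a assms(2) by algebra
    ultimately show False using maximal_left_idealD(2)[OF M(1)] by simp
  qed
  then show "\<exists>u\<in>carrier R. u \<otimes> ?f = \<one>" using f by auto (metis)
qed

text \<open>If a maximal left ideal \<open>M\<close> omits \<open>a\<close>, then M + Ra is
  everything, so some 1 - sa lies in \<open>M\<close>, and its left inverse forces 1 into
  \<open>M\<close>.\<close>

lemma jacobsonI:
  assumes a: "a \<in> carrier R"
    and inv: "\<And>t. t \<in> carrier R \<Longrightarrow> \<exists>u\<in>carrier R. u \<otimes> (\<one> \<ominus> t \<otimes> a) = \<one>"
  shows "a \<in> jacobson R"
  unfolding jacobson_def
proof (intro CollectI conjI allI impI a)
  fix M assume M: "maximal_left_ideal M R"
  note Ml = maximal_left_idealD(1)[OF M]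
  note Md = left_idealD[OF Ml]
  show "a \<in> M"
  proof (rule ccontr)
    assume "a \<notin> M"
    let ?K = "{i \<oplus> s \<otimes> a | i s. i \<in> M \<and> s \<in> carrier R}"
    have "?K = carrier R"
      using left_ideal_add_principal[OF Ml a] maximal_left_idealD(3)[OF M] \<open>a \<notin> M\<close> by blast
    then obtain i s where *: "i \<in> M" "s \<in> carrier R" "\<one> = i \<oplus> s \<otimes> a"
      using one_closed by blast
    have "i \<in> carrier R" using * Md(1) by blast
    then have "\<one> \<ominus> s \<otimes> a = i" using * a by (simp add: a_minus_def a_assoc r_neg)
    then show False using inv[of s] * Md(4) maximal_left_idealD(2)[OF M] by metis
  qed
qed

lemma left_ideal_jacobson: "left_ideal (jacobson R) R"
proof (rule left_idealI)
  show "jacobson R \<subseteq> carrier R"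
    by (auto simp: jacobson_def)
qed (auto simp: jacobson_def intro: left_idealD[OF maximal_left_idealD(1)])

text \<open>A left inverse of \<open>1 - sta\<close> yields one of \<open>1 - tas\<close>.\<close>
lemma jacobson_r_closed:
  assumes a: "a \<in> jacobson R" and s: "s \<in> carrier R"
  shows "a \<otimes> s \<in> jacobson R"
proof (rule jacobsonI)
  note ac = jacobsonD(1)[OF a s]
  show "a \<otimes> s \<in> carrier R" using ac s by simp
  fix t assume t: "t \<in> carrier R"
  obtain u where u: "u \<in> carrier R" "u \<otimes> (\<one> \<ominus> (s \<otimes> t) \<otimes> a) = \<one>"
    using jacobsonD(2)[OF a] s t by (metis m_closed)
  \<comment> \<open>The inverse is read off the geometric series: for k > 0, (tas)^k = ta
    (sta)^(k-1) s, so the series for 1 - tas is 1 + ta u s with \<open>u\<close> in the role of the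
    series for 1 - sta.\<close>
  have "(\<one> \<oplus> t \<otimes> a \<otimes> u \<otimes> s) \<otimes> (\<one> \<ominus> t \<otimes> (a \<otimes> s))
    = \<one> \<ominus> t \<otimes> a \<otimes> s \<oplus> t \<otimes> a \<otimes> (u \<otimes> (\<one> \<ominus> (s \<otimes> t) \<otimes> a)) \<otimes> s"
    using ac s t u(1) r_one[OF s] by algebra
  also have "\<dots> = \<one>"
    unfolding u(2) using ac s t by algebra
  finally show "\<exists>u\<in>carrier R. u \<otimes> (\<one> \<ominus> t \<otimes> (a \<otimes> s)) = \<one>"
    by (rule bexI) (use ac s t u(1) in simp)
qed

text \<open>A left inverse \<open>u\<close> of 1 - a satisfies u = 1 + ua, so it has a left inverse
  \<open>v\<close> itself. Having 1 - a as a right inverse as well, \<open>u\<close> is a unit, and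
  v = 1 - a.\<close>

lemma jacobson_right_inverse:
  assumes a: "a \<in> jacobson R"
  shows "\<exists>u\<in>carrier R. (\<one> \<ominus> a) \<otimes> u = \<one>"
proof -
  have ac: "a \<in> carrier R" using jacobsonD(1)[OF a] by blast
  obtain u where u: "u \<in> carrier R" "u \<otimes> (\<one> \<ominus> a) = \<one>"
    using jacobsonD(2)[OF a one_closed] ac by auto
  have "u = u \<otimes> (\<one> \<ominus> a) \<oplus> u \<otimes> a" using u(1) ac r_one[OF u(1)] by algebra
  then have eq: "\<one> \<ominus> (\<ominus> u) \<otimes> a = u"
    unfolding u(2) using u(1) ac by (simp add: a_minus_def l_minus)
  obtain v where v: "v \<in> carrier R" "v \<otimes> u = \<one>"
    using jacobsonD(2)[OF a, of "\<ominus> u"] u(1) unfolding eq by auto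
  have "v = v \<otimes> u \<otimes> (\<one> \<ominus> a)"
    using u v(1) ac by (simp add: m_assoc)
  also have "\<dots> = \<one> \<ominus> a"
    unfolding v(2) using ac by simp
  finally show ?thesis using u v by auto
qed

text \<open>In the opposite ring \<open>jacobsonI\<close> asks for right inverses of 1 - at, and at
  stays in the radical. Used for a ring and its opposite, this makes the radical the intersection of
  the maximal right ideals too.\<close>

lemma jacobson_subset_opposite: "jacobson R \<subseteq> jacobson (opposite R)"
proof
  interpret opp: ring "opposite R" by (rule ring_opposite) (rule ring_axioms)
  fix a assume a: "a \<in> jacobson R"
  show "a \<in> jacobson (opposite R)"
  proof (rule opp.jacobsonI)
    show "a \<in> carrier (opposite R)" using a by (simp add: jacobson_def)
    fix t assume "t \<in> carrier (opposite R)"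
    then show "\<exists>u\<in>carrier (opposite R). u \<otimes>\<^bsub>opposite R\<^esub>
        (\<one>\<^bsub>opposite R\<^esub> \<ominus>\<^bsub>opposite R\<^esub> t \<otimes>\<^bsub>opposite R\<^esub> a) = \<one>\<^bsub>opposite R\<^esub>"
      using jacobson_right_inverse[OF jacobson_r_closed[OF a]] by simp
  qed
qed

end

lemma jacobson_opposite: "ring S \<Longrightarrow> jacobson (opposite S) = jacobson S"
  using ring.jacobson_subset_opposite[of S] ring.jacobson_subset_opposite[OF ring_opposite, of S]
  by auto

lemma (in ring) jacobson_eq_maximal_right:
  "jacobson R = {a \<in> carrier R. \<forall>I. maximal_right_ideal I R \<longrightarrow> a \<in> I}"
  using jacobson_opposite[OF ring_axioms] by (simp add: jacobson_def)

lemma (in ring) ideal_jacobson: "ideal (jacobson R) R"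
  unfolding ideal_iff_left_right
  using left_ideal_jacobson jacobson_r_closed by (auto simp: left_ideal_def right_ideal_def)

section \<open>Completely prime ideals\<close>

text \<open>Equivalently, the quotient by \<open>M\<close> is a nonzero, possibly noncommutative,
  domain; the elementwise form avoids quotient rings.\<close>

definition completely_prime :: "'a set \<Rightarrow> ('a, 'b) ring_scheme \<Rightarrow> bool" where
  "completely_prime M S \<longleftrightarrow> ideal M S \<and> \<one>\<^bsub>S\<^esub> \<notin> M \<and>
     (\<forall>a\<in>carrier S. \<forall>b\<in>carrier S. a \<otimes>\<^bsub>S\<^esub> b \<in> M \<longrightarrow> a \<in> M \<or> b \<in> M)"

context ring
begin

lemma ideal_opposite: "ideal I (opposite R) = ideal I R"
proof -
  interpret opp: ring "opposite R" by (rule ring_opposite) (rule ring_axioms)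
  show ?thesis
    by (auto simp: ideal_iff_left_right opp.ideal_iff_left_right)
qed

lemma completely_prime_opposite: "completely_prime M (opposite R) = completely_prime M R"
  by (auto simp: completely_prime_def ideal_opposite)

lemma completely_prime_mult:
  "completely_prime M R \<Longrightarrow> a \<in> carrier R \<Longrightarrow> b \<in> carrier R \<Longrightarrow> a \<notin> M \<Longrightarrow> b \<notin> M \<Longrightarrow> a \<otimes> b \<notin> M"
  by (auto simp: completely_prime_def)

text \<open>For b outside \<open>M\<close>, the left ideal of all t with tb in \<open>M\<close>
  contains \<open>M\<close>, because \<open>M\<close> is two-sided, and omits 1; by maximality it is
  \<open>M\<close>.\<close>

lemma completely_prime_if_maximal_left:
  assumes M: "maximal_left_ideal M R" and "ideal M R"
  shows "completely_prime M R"
proof -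
  interpret ideal M R by fact
  have "a \<in> M" if a: "a \<in> carrier R" and b: "b \<in> carrier R" "b \<notin> M" and ab: "a \<otimes> b \<in> M" for a b
  proof -
    let ?K = "{t \<in> carrier R. t \<otimes> b \<in> M}"
    have "left_ideal ?K R"
      by (rule left_idealI) (auto simp: b l_distr m_assoc I_l_closed)
    moreover have "M \<subseteq> ?K"
      using b I_r_closed by auto
    moreover have "\<one> \<notin> ?K"
      using b by simp
    ultimately have "?K = M"
      using maximal_left_idealD(3)[OF M] by blast
    then show ?thesis
      using a ab by blast
  qed
  then show ?thesis
    using maximal_left_idealD(2)[OF M] \<open>ideal M R\<close> unfolding completely_prime_def by blast
qed

text \<open>Modulo \<open>M\<close> one has yw = -1, and cancelling \<open>w\<close> in (1 + wy)w =
  w(1 + yw) gives wy = -1. Hence w[y,b]w = (wy)bw - wb(yw) = wb - bw.\<close>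

lemma conjugated_commutator_mem:
  assumes M: "completely_prime M R"
    and carr: "y \<in> carrier R" "w \<in> carrier R" "b \<in> carrier R"
    and w: "w \<notin> M" and f: "\<one> \<oplus> y \<otimes> w \<in> M"
  shows "w \<otimes> (y \<otimes> b \<ominus> b \<otimes> y) \<otimes> w \<ominus> (w \<otimes> b \<ominus> b \<otimes> w) \<in> M"
proof -
  interpret ideal M R using M by (simp add: completely_prime_def)
  have "(\<one> \<oplus> w \<otimes> y) \<otimes> w = w \<otimes> (\<one> \<oplus> y \<otimes> w)"
    using carr r_one[OF carr(2)] by algebra
  then have "(\<one> \<oplus> w \<otimes> y) \<otimes> w \<in> M"
    using f carr I_l_closed by simp
  then have g: "\<one> \<oplus> w \<otimes> y \<in> M"
    using completely_prime_mult[OF M _ carr(2) _ w, of "\<one> \<oplus> w \<otimes> y"] carr by blast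
  have "(\<one> \<oplus> w \<otimes> y) \<otimes> (b \<otimes> w) \<ominus> (w \<otimes> b) \<otimes> (\<one> \<oplus> y \<otimes> w) \<in> M"
    using f g carr I_l_closed I_r_closed by (simp add: a_minus_def)
  moreover have "w \<otimes> (y \<otimes> b \<ominus> b \<otimes> y) \<otimes> w \<ominus> (w \<otimes> b \<ominus> b \<otimes> w)
    = (\<one> \<oplus> w \<otimes> y) \<otimes> (b \<otimes> w) \<ominus> (w \<otimes> b) \<otimes> (\<one> \<oplus> y \<otimes> w)"
    using carr r_one[OF carr(3)] r_one[OF carr(2)] by algebra
  ultimately show ?thesis by simp
qed

lemma no_compatible_completely_prime:
  assumes M: "completely_prime M R"
    and carr: "y \<in> carrier R" "b \<in> carrier R"
    and z_def: "z = y \<otimes> b \<ominus> b \<otimes> y"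
    and z: "z \<notin> M" and f: "\<one> \<oplus> y \<otimes> (z \<otimes> z) \<in> M"
    and cube: "z \<otimes> z \<otimes> z \<ominus> (z \<otimes> b \<ominus> b \<otimes> z) \<in> M"
  shows False
proof -
  interpret ideal M R using M by (simp add: completely_prime_def)
  have zc: "z \<in> carrier R" using carr z_def by simp
  have zz: "z \<otimes> z \<notin> M" and zzzz: "z \<otimes> z \<otimes> (z \<otimes> z) \<notin> M" and zzz: "z \<otimes> z \<otimes> z \<notin> M"
    using completely_prime_mult[OF M] z zc by simp_all
  let ?e = "z \<otimes> z \<otimes> z \<ominus> (z \<otimes> b \<ominus> b \<otimes> z)"
  let ?d = "z \<otimes> z \<otimes> z \<otimes> (z \<otimes> z) \<ominus> (z \<otimes> z \<otimes> b \<ominus> b \<otimes> (z \<otimes> z))"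
  have d: "?d \<in> M"
    using conjugated_commutator_mem[OF M carr(1) _ carr(2) zz f] zc by (simp add: z_def[symmetric])
  \<comment> \<open>Since [z^2,b] = z[z,b] + [z,b]z, the bracketed sum is 2z^4 - [z^2,b];
    subtracting it from z^5 - [z^2,b] leaves z^4 (z - 2).\<close>
  have "?d \<ominus> (z \<otimes> ?e \<oplus> ?e \<otimes> z) \<in> M"
    using d cube zc I_l_closed I_r_closed by (simp add: a_minus_def)
  moreover have "?d \<ominus> (z \<otimes> ?e \<oplus> ?e \<otimes> z) = z \<otimes> z \<otimes> (z \<otimes> z) \<otimes> (z \<ominus> (\<one> \<oplus> \<one>))"
    using zc carr r_one[OF zc] by algebra
  ultimately have two: "z \<ominus> (\<one> \<oplus> \<one>) \<in> M"
    using completely_prime_mult[OF M _ _ zzzz, of "z \<ominus> (\<one> \<oplus> \<one>)"] zc by auto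
  \<comment> \<open>As 2 is central, z - 2 and \<open>z\<close> have the same commutator with
    \<open>b\<close>, so the brackets cancel and z^3 remains.\<close>
  have "?e \<oplus> ((z \<ominus> (\<one> \<oplus> \<one>)) \<otimes> b \<ominus> b \<otimes> (z \<ominus> (\<one> \<oplus> \<one>))) \<in> M"
    using two cube carr I_l_closed I_r_closed by (simp add: a_minus_def)
  moreover have "?e \<oplus> ((z \<ominus> (\<one> \<oplus> \<one>)) \<otimes> b \<ominus> b \<otimes> (z \<ominus> (\<one> \<oplus> \<one>))) = z \<otimes> z \<otimes> z"
    using zc carr r_one[OF carr(2)] by algebra
  ultimately show False
    using zzz by simp
qed

end

section \<open>Differential polynomial rings\<close>

locale differential_polynomial_ring =
  fixes S :: "('a, 'b) ring_scheme" (structure) and R :: "'a set" and \<delta> :: "'a \<Rightarrow> 'a" and x :: 'a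
  assumes is_diff_poly_ring: "is_diff_poly_ring S R \<delta> x"

sublocale differential_polynomial_ring \<subseteq> ring S
  using is_diff_poly_ring by (simp add: is_diff_poly_ring_def)

context differential_polynomial_ring
begin

lemma x_closed [simp]: "x \<in> carrier S"
  and x_times: "r \<in> R \<Longrightarrow> x \<otimes> r = r \<otimes> x \<oplus> \<delta> r"
  and \<delta>_closed: "r \<in> R \<Longrightarrow> \<delta> r \<in> R"
  and subring: "subring R S"
  using is_diff_poly_ring by (auto simp: is_diff_poly_ring_def derivation_on_def)

lemmas R_subring = subringE[OF subring]

lemma R_carrier [simp]: "r \<in> R \<Longrightarrow> r \<in> carrier S"
  using R_subring(1) by blast

section \<open>Ideals of the coefficient ring stable under the derivation\<close>

definition diff_ideal :: "'a set \<Rightarrow> bool" where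
  "diff_ideal P \<longleftrightarrow> P \<subseteq> R \<and> \<zero> \<in> P \<and> (\<forall>p\<in>P. \<forall>q\<in>P. p \<oplus> q \<in> P) \<and>
     (\<forall>p\<in>P. \<forall>r\<in>R. r \<otimes> p \<in> P \<and> p \<otimes> r \<in> P) \<and> (\<forall>p\<in>P. \<delta> p \<in> P)"

lemma diff_idealD:
  assumes "diff_ideal P"
  shows "P \<subseteq> R" "\<zero> \<in> P" "\<And>p q. p \<in> P \<Longrightarrow> q \<in> P \<Longrightarrow> p \<oplus> q \<in> P"
    "\<And>p r. p \<in> P \<Longrightarrow> r \<in> R \<Longrightarrow> r \<otimes> p \<in> P" "\<And>p r. p \<in> P \<Longrightarrow> r \<in> R \<Longrightarrow> p \<otimes> r \<in> P"
    "\<And>p. p \<in> P \<Longrightarrow> \<delta> p \<in> P" "\<And>p. p \<in> P \<Longrightarrow> p \<in> R" "\<And>p. p \<in> P \<Longrightarrow> p \<in> carrier S"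
  using assms R_subring(1) by (auto simp: diff_ideal_def)

text \<open>With this instance the results on \<open>polys P n\<close> also cover arbitrary
  polynomials of bounded degree.\<close>

lemma diff_ideal_R: "diff_ideal R"
  using R_subring \<delta>_closed by (auto simp: diff_ideal_def)

text \<open>If \<open>p \<in> M\<close>, then \<open>\<delta> p = xp - px \<in> M\<close>.\<close>
lemma diff_ideal_contraction:
  assumes "ideal M S"
  shows "diff_ideal (M \<inter> R)"
proof -
  interpret ideal M S by fact
  have "\<delta> p \<in> M" if "p \<in> M" "p \<in> R" for p
  proof -
    have "x \<otimes> p \<ominus> p \<otimes> x \<in> M"
      using that I_l_closed I_r_closed by (simp add: a_minus_def)
    moreover have "x \<otimes> p \<ominus> p \<otimes> x = \<delta> p"
      unfolding x_times[OF that(2)] using that \<delta>_closed R_carrier x_closed by algebra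
    ultimately show ?thesis by simp
  qed
  then show ?thesis
    using R_subring \<delta>_closed I_l_closed I_r_closed by (auto simp: diff_ideal_def)
qed

section \<open>Polynomials with coefficients in a stable ideal\<close>

text \<open>Coefficients in \<open>P\<close> and degree strictly less than \<open>n\<close>.\<close>
primrec polys :: "'a set \<Rightarrow> nat \<Rightarrow> 'a set" where
  "polys P 0 = {\<zero>}"
| "polys P (Suc n) = {u \<oplus> p \<otimes> x [^] n | u p. u \<in> polys P n \<and> p \<in> P}"

lemma polys_SucI: "u \<in> polys P n \<Longrightarrow> p \<in> P \<Longrightarrow> u \<oplus> p \<otimes> x [^] n \<in> polys P (Suc n)"
  by auto

text \<open>Links the recursion, suited to induction on the degree, with the sums by which
  \<open>is_diff_poly_ring\<close> expresses spanning and freeness.\<close>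

lemma polys_R_iff:
  "u \<in> polys R n \<longleftrightarrow> (\<exists>f. f \<in> {..<n} \<rightarrow> R \<and> u = (\<Oplus>i\<in>{..<n}. f i \<otimes> x [^] i))"
proof (induction n arbitrary: u)
  case 0
  show ?case by auto
next
  case (Suc n)
  have sum: "(\<Oplus>i\<in>{..<Suc n}. f i \<otimes> x [^] i) = (\<Oplus>i\<in>{..<n}. f i \<otimes> x [^] i) \<oplus> f n \<otimes> x [^] n"
    if "f \<in> {..<Suc n} \<rightarrow> R" for f
  proof -
    have "(\<lambda>i. f i \<otimes> x [^] i) \<in> {..<n} \<rightarrow> carrier S" "f n \<otimes> x [^] n \<in> carrier S"
      using that by (auto simp: Pi_iff)
    then show ?thesis
      by (simp add: lessThan_Suc a_comm)
  qed
  show ?case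
  proof
    assume "u \<in> polys R (Suc n)"
    then obtain v p f where v: "p \<in> R" "u = v \<oplus> p \<otimes> x [^] n"
      and f: "f \<in> {..<n} \<rightarrow> R" "v = (\<Oplus>i\<in>{..<n}. f i \<otimes> x [^] i)"
      using Suc.IH by auto
    have g: "f(n := p) \<in> {..<Suc n} \<rightarrow> R"
      using f v by (auto simp: less_Suc_eq)
    have "v = (\<Oplus>i\<in>{..<n}. (f(n := p)) i \<otimes> x [^] i)"
      unfolding f(2) by (rule finsum_cong') (use f(1) in \<open>auto simp: Pi_iff\<close>)
    then have "u = (\<Oplus>i\<in>{..<Suc n}. (f(n := p)) i \<otimes> x [^] i)"
      unfolding sum[OF g] v(2) by simp
    then show "\<exists>f. f \<in> {..<Suc n} \<rightarrow> R \<and> u = (\<Oplus>i\<in>{..<Suc n}. f i \<otimes> x [^] i)"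
      using g by blast
  next
    assume "\<exists>f. f \<in> {..<Suc n} \<rightarrow> R \<and> u = (\<Oplus>i\<in>{..<Suc n}. f i \<otimes> x [^] i)"
    then obtain f where f: "f \<in> {..<Suc n} \<rightarrow> R" "u = (\<Oplus>i\<in>{..<Suc n}. f i \<otimes> x [^] i)"
      by blast
    have "(\<Oplus>i\<in>{..<n}. f i \<otimes> x [^] i) \<in> polys R n"
      unfolding Suc.IH using f(1) by (intro exI[of _ f]) (auto simp: Pi_iff)
    then show "u \<in> polys R (Suc n)"
      unfolding f(2) sum[OF f(1)] using f(1) by (intro polys_SucI) (auto simp: Pi_iff)
  qed
qed

lemma carrier_eq_polys: "s \<in> carrier S \<Longrightarrow> \<exists>n. s \<in> polys R n"
  using is_diff_poly_ring unfolding is_diff_poly_ring_def polys_R_iff by blast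

text \<open>Freeness of the powers of \<open>x\<close>, reduced to the top coefficient, the only one
  that degree arguments look at.\<close>

lemma leading_coeff_zero:
  assumes "u \<in> polys R n" "r \<in> R" "u \<oplus> r \<otimes> x [^] n = \<zero>"
  shows "r = \<zero>"
proof -
  obtain f where f: "f \<in> {..<n} \<rightarrow> R" "u = (\<Oplus>i\<in>{..<n}. f i \<otimes> x [^] i)"
    using assms(1) unfolding polys_R_iff by blast
  let ?g = "f(n := r)"
  have g: "?g \<in> {..<Suc n} \<rightarrow> R"
    using f assms(2) by (auto simp: less_Suc_eq)
  have "(\<Oplus>i\<in>{..<n}. ?g i \<otimes> x [^] i) = u"
    unfolding f(2) by (rule finsum_cong') (use f(1) in \<open>auto simp: Pi_iff\<close>)
  moreover have "(\<lambda>i. ?g i \<otimes> x [^] i) \<in> {..<n} \<rightarrow> carrier S" "r \<otimes> x [^] n \<in> carrier S"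
    using f(1) assms(2) by (auto simp: Pi_iff)
  moreover have "u \<in> carrier S"
    unfolding f(2) by (rule finsum_closed) (use f(1) in \<open>auto simp: Pi_iff\<close>)
  ultimately have "(\<Oplus>i\<in>{..<Suc n}. ?g i \<otimes> x [^] i) = u \<oplus> r \<otimes> x [^] n"
    by (simp add: lessThan_Suc a_comm)
  then have "\<forall>i<Suc n. ?g i = \<zero>"
    using is_diff_poly_ring g assms(3) unfolding is_diff_poly_ring_def by metis
  then show ?thesis by auto
qed

lemma polys_mono: "P \<subseteq> Q \<Longrightarrow> u \<in> polys P n \<Longrightarrow> u \<in> polys Q n"
  by (induction n arbitrary: u) auto

context
  fixes P :: "'a set"
  assumes P: "diff_ideal P"
begin

lemma polys_carrier: "u \<in> polys P n \<Longrightarrow> u \<in> carrier S"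
  by (induction n arbitrary: u) (auto dest: diff_idealD(8)[OF P])

lemma polys_Suc: "u \<in> polys P n \<Longrightarrow> u \<in> polys P (Suc n)"
  using polys_SucI[OF _ diff_idealD(2)[OF P], of u n] polys_carrier[of u n] by simp

lemma polys_le: "m \<le> n \<Longrightarrow> u \<in> polys P m \<Longrightarrow> u \<in> polys P n"
  by (induction n rule: dec_induct) (auto simp del: polys.simps intro: polys_Suc)

lemma polys_zero: "\<zero> \<in> polys P n"
  using polys_le[of 0 n] by simp

lemma polys_add: "u \<in> polys P n \<Longrightarrow> v \<in> polys P n \<Longrightarrow> u \<oplus> v \<in> polys P n"
proof (induction n arbitrary: u v)
  case (Suc n)
  then obtain u' v' p q where *: "u' \<in> polys P n" "v' \<in> polys P n" "p \<in> P" "q \<in> P"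
    "u = u' \<oplus> p \<otimes> x [^] n" "v = v' \<oplus> q \<otimes> x [^] n" by auto
  then have "u \<oplus> v = (u' \<oplus> v') \<oplus> (p \<oplus> q) \<otimes> x [^] n"
    using polys_carrier diff_idealD(8)[OF P] by (simp add: l_distr a_ac)
  then show ?case
    using * Suc.IH diff_idealD(3)[OF P] by (auto simp del: polys.simps intro: polys_SucI)
qed simp

lemma polys_monom: "p \<in> P \<Longrightarrow> p \<otimes> x [^] n \<in> polys P (Suc n)"
  using polys_SucI[OF polys_zero, of p n] diff_idealD(8)[OF P] by simp

lemma polys_lmult: "r \<in> R \<Longrightarrow> u \<in> polys P n \<Longrightarrow> r \<otimes> u \<in> polys P n"
proof (induction n arbitrary: u)
  case (Suc n)
  then obtain v p where *: "v \<in> polys P n" "p \<in> P" "u = v \<oplus> p \<otimes> x [^] n" by auto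
  then have "r \<otimes> u = r \<otimes> v \<oplus> (r \<otimes> p) \<otimes> x [^] n"
    using polys_carrier diff_idealD(8)[OF P] Suc.prems by (simp add: r_distr m_assoc)
  then show ?case
    using * Suc diff_idealD(4)[OF P] by (auto simp del: polys.simps intro: polys_SucI)
qed simp

lemma polys_uminus: "u \<in> polys P n \<Longrightarrow> \<ominus> u \<in> polys P n"
  using polys_lmult[of "\<ominus> \<one>" u n] R_subring(3,5) polys_carrier by (simp add: l_minus)

lemma polys_minus: "u \<in> polys P n \<Longrightarrow> v \<in> polys P n \<Longrightarrow> u \<ominus> v \<in> polys P n"
  unfolding a_minus_def by (intro polys_add polys_uminus)

text \<open>From x p x^n = p x^(n+1) + \<delta>(p) x^n: stability of \<open>P\<close> under \<delta>
  keeps the extra term inside.\<close>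

lemma polys_x_l: "u \<in> polys P n \<Longrightarrow> x \<otimes> u \<in> polys P (Suc n)"
proof (induction n arbitrary: u)
  case 0
  then show ?case using polys_zero[of "Suc 0"] by simp
next
  case (Suc n)
  then obtain v p where *: "v \<in> polys P n" "p \<in> P" "u = v \<oplus> p \<otimes> x [^] n" by auto
  note p = diff_idealD(7,8)[OF P *(2)]
  have dp: "\<delta> p \<in> carrier S" using \<delta>_closed p by simp
  have "x \<otimes> u = x \<otimes> v \<oplus> (x \<otimes> p) \<otimes> x [^] n"
    using * p polys_carrier by (simp add: r_distr m_assoc)
  also have "\<dots> = (x \<otimes> v \<oplus> \<delta> p \<otimes> x [^] n) \<oplus> p \<otimes> x [^] Suc n"
    unfolding x_times[OF p(1)] nat_pow_Suc2[OF x_closed]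
    using * p dp polys_carrier by (simp add: l_distr m_assoc a_ac)
  finally show ?case
    using polys_SucI[OF polys_add[OF Suc.IH[OF *(1)] polys_monom[OF diff_idealD(6)[OF P *(2)]]] *(2)]
    by metis
qed

lemma polys_x_r: "u \<in> polys P n \<Longrightarrow> u \<otimes> x \<in> polys P (Suc n)"
proof (induction n arbitrary: u)
  case 0
  then show ?case using polys_zero[of "Suc 0"] by simp
next
  case (Suc n)
  then obtain v p where *: "v \<in> polys P n" "p \<in> P" "u = v \<oplus> p \<otimes> x [^] n" by auto
  then have "u \<otimes> x = v \<otimes> x \<oplus> p \<otimes> x [^] Suc n"
    using diff_idealD(8)[OF P] polys_carrier by (simp add: l_distr m_assoc)
  then show ?case
    using polys_SucI[OF Suc.IH[OF *(1)] *(2)] by metis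
qed

text \<open>Serves \<open>polys_rmult\<close>: moving r past x^n creates lower terms with arbitrary
  coefficients in \<open>R\<close>, and a factor from \<open>P\<close> on the left brings them back
  into \<open>P\<close>.\<close>

lemma polys_coeff_l: "p \<in> P \<Longrightarrow> v \<in> polys R n \<Longrightarrow> p \<otimes> v \<in> polys P n"
proof (induction n arbitrary: v)
  case 0
  then show ?case using diff_idealD(8)[OF P] by simp
next
  case (Suc n)
  then obtain u r where *: "u \<in> polys R n" "r \<in> R" "v = u \<oplus> r \<otimes> x [^] n" by auto
  have "u \<in> carrier S"
    using *(1) by (induction n arbitrary: u) auto
  then have "p \<otimes> v = p \<otimes> u \<oplus> (p \<otimes> r) \<otimes> x [^] n"
    using * diff_idealD(8)[OF P] Suc.prems by (simp add: r_distr m_assoc)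
  then show ?case
    using * Suc diff_idealD(5)[OF P] by (auto simp del: polys.simps intro: polys_SucI)
qed

end

text \<open>Each use of xr = rx + \<delta>(r) disturbs lower degrees only, so leading coefficients
  multiply as for ordinary polynomials.\<close>

lemma pow_times:
  assumes r: "r \<in> R"
  shows "\<exists>v\<in>polys R n. x [^] n \<otimes> r = r \<otimes> x [^] n \<oplus> v"
proof (induction n)
  case 0
  then show ?case using r by simp
next
  case (Suc n)
  then obtain v where v: "v \<in> polys R n" "x [^] n \<otimes> r = r \<otimes> x [^] n \<oplus> v" by blast
  note vc = polys_carrier[OF diff_ideal_R v(1)]
  have "x [^] Suc n \<otimes> r = x \<otimes> (r \<otimes> x [^] n \<oplus> v)"
    unfolding v(2)[symmetric] nat_pow_Suc2[OF x_closed] using r by (simp add: m_assoc)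
  also have "\<dots> = (x \<otimes> r) \<otimes> x [^] n \<oplus> x \<otimes> v"
    using r vc by (simp add: r_distr m_assoc)
  also have "\<dots> = r \<otimes> x [^] Suc n \<oplus> (\<delta> r \<otimes> x [^] n \<oplus> x \<otimes> v)"
    unfolding x_times[OF r] nat_pow_Suc2[OF x_closed]
    using r vc \<delta>_closed by (simp add: l_distr m_assoc a_ac)
  finally show ?case
    using polys_add[OF diff_ideal_R polys_monom[OF diff_ideal_R \<delta>_closed[OF r]]
        polys_x_l[OF diff_ideal_R v(1)]] by blast
qed

lemma polys_rmult:
  assumes P: "diff_ideal P" and r: "r \<in> R"
  shows "u \<in> polys P n \<Longrightarrow> u \<otimes> r \<in> polys P n"
proof (induction n arbitrary: u)
  case 0
  then show ?case using r by simp
next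
  case (Suc n)
  then obtain v p where *: "v \<in> polys P n" "p \<in> P" "u = v \<oplus> p \<otimes> x [^] n" by auto
  obtain w where w: "w \<in> polys R n" "x [^] n \<otimes> r = r \<otimes> x [^] n \<oplus> w"
    using pow_times[OF r] by blast
  note carr = diff_idealD(8)[OF P *(2)] polys_carrier[OF P *(1)] polys_carrier[OF diff_ideal_R w(1)]
  have "u \<otimes> r = v \<otimes> r \<oplus> p \<otimes> (x [^] n \<otimes> r)"
    using * carr r by (simp add: l_distr m_assoc)
  also have "\<dots> = (v \<otimes> r \<oplus> p \<otimes> w) \<oplus> (p \<otimes> r) \<otimes> x [^] n"
    unfolding w(2) using carr r by (simp add: r_distr m_assoc a_ac)
  finally show ?case
    using Suc.IH[OF *(1)] * w(1) diff_idealD(5)[OF P *(2) r]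
    by (simp del: polys.simps add: polys_SucI polys_add polys_coeff_l P)
qed

text \<open>For \<delta>-stable \<open>P\<close> this is P[x], the kernel of the map from
  \<open>S\<close> onto (R/P)[x;\<delta>].\<close>

definition ext_ideal :: "'a set \<Rightarrow> 'a set" where
  "ext_ideal P = (\<Union>n. polys P n)"

lemma ext_ideal_iff: "u \<in> ext_ideal P \<longleftrightarrow> (\<exists>n. u \<in> polys P n)"
  by (simp add: ext_ideal_def)

lemma ext_idealI: "u \<in> polys P n \<Longrightarrow> u \<in> ext_ideal P"
  by (auto simp: ext_ideal_def)

text \<open>The degreewise lemmas give stability under \<open>R\<close> and \<open>x\<close> on both
  sides; as the products r x^n span \<open>S\<close>, induction on the degree of the multiplier does
  the rest.\<close>

lemma ideal_ext_ideal:
  assumes P: "diff_ideal P"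
  shows "ideal (ext_ideal P) S"
proof -
  interpret opp: ring "opposite S" by (rule ring_opposite) (rule ring_axioms)
  have carr: "u \<in> carrier S" if "u \<in> ext_ideal P" for u
    using that polys_carrier[OF P] by (auto simp: ext_ideal_iff)
  have zero: "\<zero> \<in> ext_ideal P"
    using ext_idealI polys_zero[OF P] by blast
  have add: "u \<oplus> v \<in> ext_ideal P" if uv: "u \<in> ext_ideal P" "v \<in> ext_ideal P" for u v
  proof -
    obtain m n where mn: "u \<in> polys P m" "v \<in> polys P n"
      using uv by (auto simp: ext_ideal_iff)
    then have "u \<in> polys P (max m n)" "v \<in> polys P (max m n)"
      using polys_le[OF P] by (meson max.cobounded1 max.cobounded2)+
    then show ?thesis
      using ext_idealI polys_add[OF P] by blast
  qed
  have R_l: "r \<otimes> u \<in> ext_ideal P" and R_r: "u \<otimes> r \<in> ext_ideal P"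
    if "r \<in> R" "u \<in> ext_ideal P" for r u
    using that polys_lmult[OF P] polys_rmult[OF P] unfolding ext_ideal_iff by blast+
  have x_l: "x \<otimes> u \<in> ext_ideal P" and x_r: "u \<otimes> x \<in> ext_ideal P" if "u \<in> ext_ideal P" for u
    using that polys_x_l[OF P] polys_x_r[OF P] unfolding ext_ideal_iff by blast+
  have pow_l: "x [^] n \<otimes> u \<in> ext_ideal P" if "u \<in> ext_ideal P" for u and n :: nat
    using that
  proof (induction n)
    case (Suc n)
    then show ?case
      using x_l[of "x [^] n \<otimes> u"] carr unfolding nat_pow_Suc2[OF x_closed] by (simp add: m_assoc)
  qed (use carr in simp)
  have pow_r: "u \<otimes> x [^] n \<in> ext_ideal P" if "u \<in> ext_ideal P" for u and n :: nat
    using that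
  proof (induction n)
    case (Suc n)
    then show ?case
      using x_r[of "u \<otimes> x [^] n"] carr by (simp add: m_assoc)
  qed (use carr in simp)
  have "s \<otimes> u \<in> ext_ideal P \<and> u \<otimes> s \<in> ext_ideal P"
    if u: "u \<in> ext_ideal P" and "s \<in> polys R n" for u s n
    using that(2)
  proof (induction n arbitrary: s)
    case 0
    then show ?case using zero carr u by simp
  next
    case (Suc n)
    then obtain v p where *: "v \<in> polys R n" "p \<in> R" "s = v \<oplus> p \<otimes> x [^] n" by auto
    have "s \<otimes> u = v \<otimes> u \<oplus> p \<otimes> (x [^] n \<otimes> u)" "u \<otimes> s = u \<otimes> v \<oplus> (u \<otimes> p) \<otimes> x [^] n"
      using * carr u polys_carrier[OF diff_ideal_R] by (simp_all add: l_distr r_distr m_assoc)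
    then show ?case
      using Suc.IH[OF *(1)] pow_l[OF u] pow_r[OF R_r[OF *(2) u]] R_l *(2) add by simp
  qed
  then have mult: "s \<otimes> u \<in> ext_ideal P" "u \<otimes> s \<in> ext_ideal P"
    if "u \<in> ext_ideal P" "s \<in> carrier S" for u s
    using that carrier_eq_polys by blast+
  have "left_ideal (ext_ideal P) S"
    by (rule left_idealI) (use carr zero add mult in auto)
  moreover have "left_ideal (ext_ideal P) (opposite S)"
    by (rule opp.left_idealI) (use carr zero add mult in auto)
  ultimately show ?thesis
    by (simp add: ideal_iff_left_right)
qed

text \<open>An expression v + p x^m over \<open>P\<close> for the same element need not have m = n.
  By freeness, m < n forces r = 0, m = n forces r = p, and m > n forces p = 0, so that m can be
  lowered.\<close>

lemma leading_coeff_ext_ideal: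
  assumes P: "diff_ideal P" and u: "u \<in> polys R n" and r: "r \<in> R"
    and ext: "u \<oplus> r \<otimes> x [^] n \<in> ext_ideal P"
  shows "r \<in> P"
proof -
  note cR = polys_carrier[OF diff_ideal_R]
  note PR = polys_mono[OF diff_idealD(1)[OF P]]
  have "r \<in> P" if "u \<oplus> r \<otimes> x [^] n \<in> polys P m" for m
    using that
  proof (induction m)
    case 0
    then show ?case
      using leading_coeff_zero[OF u r] diff_idealD(2)[OF P] by simp
  next
    case (Suc m)
    then obtain v p where v: "v \<in> polys P m" "p \<in> P" "u \<oplus> r \<otimes> x [^] n = v \<oplus> p \<otimes> x [^] m" by auto
    note pR = diff_idealD(7)[OF P v(2)]
    note carr = cR[OF u] cR[OF PR[OF v(1)]] R_carrier[OF r] R_carrier[OF pR]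
    consider "m < n" | "m = n" | "n < m" by linarith
    then show ?case
    proof cases
      case 1
      have "v \<oplus> p \<otimes> x [^] m \<in> polys R n"
        using polys_le[OF diff_ideal_R, of "Suc m" n] polys_SucI[OF PR[OF v(1)] pR] 1 by simp
      then have *: "u \<ominus> (v \<oplus> p \<otimes> x [^] m) \<in> polys R n"
        using polys_minus[OF diff_ideal_R u] by blast
      have "(u \<ominus> (v \<oplus> p \<otimes> x [^] m)) \<oplus> r \<otimes> x [^] n = (u \<oplus> r \<otimes> x [^] n) \<ominus> (v \<oplus> p \<otimes> x [^] m)"
        using carr by (simp add: a_minus_def a_ac)
      also have "\<dots> = \<zero>"
        unfolding v(3) using carr by (simp add: a_minus_def r_neg)
      finally show ?thesis
        using leading_coeff_zero[OF * r] diff_idealD(2)[OF P] by simp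
    next
      case 2
      have *: "u \<ominus> v \<in> polys R n"
        using polys_minus[OF diff_ideal_R u] PR v(1) 2 by blast
      have rp: "r \<ominus> p \<in> R"
        using R_subring(5,7) r pR by (simp add: a_minus_def)
      have "(u \<ominus> v) \<oplus> (r \<ominus> p) \<otimes> x [^] n = (u \<oplus> r \<otimes> x [^] n) \<ominus> (v \<oplus> p \<otimes> x [^] m)"
        using carr 2 by (simp add: a_minus_def l_distr l_minus minus_add a_ac)
      also have "\<dots> = \<zero>"
        unfolding v(3) using carr by (simp add: a_minus_def r_neg)
      finally have "r \<ominus> p = \<zero>"
        using leading_coeff_zero[OF * rp] by simp
      then have "r = p"
        using carr by simp
      then show ?thesis using v(2) by simp
    next
      case 3
      have "u \<oplus> r \<otimes> x [^] n \<in> polys R m"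
        using polys_le[OF diff_ideal_R, of "Suc n" m] polys_SucI[OF u r] 3 by simp
      then have *: "v \<ominus> (u \<oplus> r \<otimes> x [^] n) \<in> polys R m"
        using polys_minus[OF diff_ideal_R] PR v(1) by blast
      have "(v \<ominus> (u \<oplus> r \<otimes> x [^] n)) \<oplus> p \<otimes> x [^] m = (v \<oplus> p \<otimes> x [^] m) \<ominus> (u \<oplus> r \<otimes> x [^] n)"
        using carr by (simp add: a_minus_def a_ac)
      also have "\<dots> = \<zero>"
        unfolding v(3) using carr by (simp add: a_minus_def r_neg)
      finally have "p = \<zero>"
        using leading_coeff_zero[OF * pR] by simp
      then have "u \<oplus> r \<otimes> x [^] n = v"
        using v(3) carr by simp
      then show ?thesis
        using Suc.IH v(1) by simp
    qed
  qed
  then show ?thesis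
    using ext by (auto simp: ext_ideal_iff)
qed

text \<open>Top terms with coefficient in \<open>P\<close> are moved into \<open>j\<close> until the
  leading coefficient lies outside \<open>P\<close>; then \<open>n\<close> is the degree over
  R/P.\<close>

lemma leading_term_mod_ext_ideal:
  assumes P: "diff_ideal P" and s: "s \<in> polys R m"
  shows "s \<in> ext_ideal P \<or> (\<exists>n u c j. u \<in> polys R n \<and> c \<in> R - P \<and> j \<in> ext_ideal P \<and>
           s = (u \<oplus> c \<otimes> x [^] n) \<oplus> j)"
  using s
proof (induction m arbitrary: s)
  case 0
  then show ?case
    using ext_idealI polys_zero[OF P] by fastforce
next
  case (Suc m)
  interpret I: ideal "ext_ideal P" S by (rule ideal_ext_ideal) (rule P)
  note cR = polys_carrier[OF diff_ideal_R]
  from Suc.prems obtain v p where v: "v \<in> polys R m" "p \<in> R" "s = v \<oplus> p \<otimes> x [^] m" by auto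
  have pc: "p \<otimes> x [^] m \<in> carrier S" using v(2) by simp
  show ?case
  proof (cases "p \<in> P")
    case False
    then have "s = (v \<oplus> p \<otimes> x [^] m) \<oplus> \<zero>"
      using v cR[OF v(1)] pc by simp
    then show ?thesis
      using v False I.zero_closed by blast
  next
    case True
    then have px: "p \<otimes> x [^] m \<in> ext_ideal P"
      using ext_idealI polys_monom[OF P] by blast
    from Suc.IH[OF v(1)] show ?thesis
    proof (elim disjE exE conjE)
      assume "v \<in> ext_ideal P"
      then show ?thesis using px v(3) by simp
    next
      fix n u c j
      assume *: "u \<in> polys R n" "c \<in> R - P" "j \<in> ext_ideal P" "v = (u \<oplus> c \<otimes> x [^] n) \<oplus> j"
      have "s = (u \<oplus> c \<otimes> x [^] n) \<oplus> (j \<oplus> p \<otimes> x [^] m)"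
        unfolding v(3) *(4) using * cR pc I.Icarr by (simp add: a_assoc)
      then show ?thesis
        using * px I.a_closed by blast
    qed
  qed
qed

text \<open>Modulo \<open>P[x]\<close>, multiplication by \<open>1 + (x - a)w\<close> raises degrees by one.\<close>
lemma linear_not_invertible_mod_ext_ideal:
  assumes M: "completely_prime M S" and w: "w \<in> R" "w \<notin> M" and a: "a \<in> R"
    and i: "i \<in> ext_ideal (M \<inter> R)" and s: "s \<in> carrier S"
  defines "f \<equiv> \<one> \<oplus> (x \<ominus> a) \<otimes> w"
  shows "i \<oplus> s \<otimes> f \<noteq> \<one>" and "i \<oplus> f \<otimes> s \<noteq> \<one>"
proof -
  let ?P = "M \<inter> R"
  have "ideal M S" using M by (simp add: completely_prime_def)
  then have P: "diff_ideal ?P" by (rule diff_ideal_contraction)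
  interpret I: ideal "ext_ideal ?P" S by (rule ideal_ext_ideal) (rule P)
  note RR = diff_ideal_R
  note cR = polys_carrier[OF RR]
  note wc = R_carrier[OF w(1)] and ac = R_carrier[OF a]
  have fc: "f \<in> carrier S" using wc ac by (simp add: f_def)
  have one_P: "\<one> \<notin> ext_ideal ?P"
  proof
    assume "\<one> \<in> ext_ideal ?P"
    then have "\<zero> \<oplus> \<one> \<otimes> x [^] (0::nat) \<in> ext_ideal ?P" by simp
    then have "\<one> \<in> ?P"
      using leading_coeff_ext_ideal[OF P, of \<zero> 0 \<one>] R_subring(3) by simp
    then show False using M by (simp add: completely_prime_def)
  qed
  \<comment> \<open>Here the exponent \<open>Suc n\<close> matters: in positive degree, subtracting
    1 leaves the leading coefficient \<open>c\<close> unchanged, and \<open>c\<close> is not in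
    \<open>P\<close>.\<close>
  have no_one: "i \<oplus> (v \<oplus> c \<otimes> x [^] Suc n \<oplus> j) \<noteq> \<one>"
    if v: "v \<in> polys R (Suc n)" and c: "c \<in> R - M" and j: "j \<in> ext_ideal ?P" for v c n j
  proof
    assume eq: "i \<oplus> (v \<oplus> c \<otimes> x [^] Suc n \<oplus> j) = \<one>"
    note carr = I.Icarr[OF i] I.Icarr[OF j] cR[OF v]
    have cc: "c \<otimes> x [^] Suc n \<in> carrier S" using c by simp
    have "\<one> \<in> polys R (Suc n)"
      using polys_le[OF RR, of 1 "Suc n"] polys_monom[OF RR R_subring(3), of 0] by simp
    then have v1: "v \<ominus> \<one> \<in> polys R (Suc n)"
      using polys_minus[OF RR v] by blast
    have "(v \<ominus> \<one>) \<oplus> c \<otimes> x [^] Suc n = \<ominus> (i \<oplus> j)"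
      unfolding eq[symmetric] using carr cc by algebra
    then have "(v \<ominus> \<one>) \<oplus> c \<otimes> x [^] Suc n \<in> ext_ideal ?P"
      using i j by simp
    then show False
      using leading_coeff_ext_ideal[OF P v1] c by blast
  qed
  from carrier_eq_polys[OF s] obtain m where "s \<in> polys R m" by blast
  from leading_term_mod_ext_ideal[OF P this]
  have "i \<oplus> s \<otimes> f \<noteq> \<one> \<and> i \<oplus> f \<otimes> s \<noteq> \<one>"
  proof (elim disjE exE conjE)
    assume "s \<in> ext_ideal ?P"
    then have "i \<oplus> s \<otimes> f \<in> ext_ideal ?P" "i \<oplus> f \<otimes> s \<in> ext_ideal ?P"
      using i fc I.I_l_closed I.I_r_closed by simp_all
    then show ?thesis using one_P by metis
  next
    fix n u c j
    assume u: "u \<in> polys R n" and c: "c \<in> R - ?P" and j: "j \<in> ext_ideal ?P"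
      and s_eq: "s = (u \<oplus> c \<otimes> x [^] n) \<oplus> j"
    define t where "t = u \<oplus> c \<otimes> x [^] n"
    have cR': "c \<in> R" "c \<notin> M" using c by auto
    \<comment> \<open>These become the leading coefficients of sf and fs; complete primeness keeps
      them outside \<open>M\<close>.\<close>
    have cw: "c \<otimes> w \<in> R - M" "w \<otimes> c \<in> R - M"
      using cR' w completely_prime_mult[OF M] R_subring(6) by simp_all
    have t: "t \<in> polys R (Suc n)"
      unfolding t_def using u cR'(1) by (rule polys_SucI)
    note cc = R_carrier[OF cR'(1)] and jc = I.Icarr[OF j] and uc = cR[OF u] and tc = cR[OF t]
    obtain v where v: "v \<in> polys R (Suc n)"
      "x [^] Suc n \<otimes> w = w \<otimes> x [^] Suc n \<oplus> v"
      using pow_times[OF w(1)] by blast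
    note vc = cR[OF v(1)]
    have pc: "x [^] Suc n \<in> carrier S" "x [^] n \<in> carrier S" by (simp_all del: nat_pow_Suc)
    \<comment> \<open>The only part of sf reaching degree n + 1 modulo P[x]; its top term comes from
      c x^(n+1) w.\<close>
    have "t \<otimes> x \<otimes> w = u \<otimes> x \<otimes> w \<oplus> c \<otimes> (x [^] Suc n \<otimes> w)"
      unfolding t_def using uc cc wc by (simp add: l_distr m_assoc)
    also have "\<dots> = (u \<otimes> x \<otimes> w \<oplus> c \<otimes> v) \<oplus> (c \<otimes> w) \<otimes> x [^] Suc n"
      unfolding v(2) using uc cc wc vc pc x_closed by algebra
    finally have txw: "t \<otimes> x \<otimes> w = (u \<otimes> x \<otimes> w \<oplus> c \<otimes> v) \<oplus> (c \<otimes> w) \<otimes> x [^] Suc n" .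
    have "s \<otimes> f = (t \<ominus> t \<otimes> a \<otimes> w) \<oplus> t \<otimes> x \<otimes> w \<oplus> j \<otimes> f"
      unfolding s_eq t_def[symmetric] f_def using tc ac wc jc x_closed r_one[OF tc] r_one[OF jc]
      by algebra
    also have "\<dots> = ((t \<ominus> t \<otimes> a \<otimes> w) \<oplus> (u \<otimes> x \<otimes> w \<oplus> c \<otimes> v)) \<oplus> (c \<otimes> w) \<otimes> x [^] Suc n \<oplus> j \<otimes> f"
      unfolding txw using tc uc ac wc jc cc vc pc fc x_closed by algebra
    finally have sf: "s \<otimes> f =
      ((t \<ominus> t \<otimes> a \<otimes> w) \<oplus> (u \<otimes> x \<otimes> w \<oplus> c \<otimes> v)) \<oplus> (c \<otimes> w) \<otimes> x [^] Suc n \<oplus> j \<otimes> f" .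
    have left: "i \<oplus> s \<otimes> f \<noteq> \<one>"
      unfolding sf
    proof (rule no_one)
      show "(t \<ominus> t \<otimes> a \<otimes> w) \<oplus> (u \<otimes> x \<otimes> w \<oplus> c \<otimes> v) \<in> polys R (Suc n)"
        using t u v(1) a w(1) cR'(1)
        by (intro polys_add polys_minus polys_rmult polys_lmult polys_x_r RR)
      show "j \<otimes> f \<in> ext_ideal ?P" using j fc I.I_r_closed by blast
    qed (rule cw)
    have dc: "\<delta> (w \<otimes> c) \<in> R" using cw \<delta>_closed by blast
    note dcc = R_carrier[OF dc]
    \<comment> \<open>On this side \<open>w\<close> is first absorbed into the coefficient, and
      \<open>x\<close> then passes wc at the cost of \<delta>(wc) x^n.\<close>
    have "x \<otimes> (w \<otimes> t) = x \<otimes> (w \<otimes> u) \<oplus> (x \<otimes> (w \<otimes> c)) \<otimes> x [^] n"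
      unfolding t_def using uc cc wc pc x_closed by algebra
    also have "\<dots> = (x \<otimes> (w \<otimes> u) \<oplus> \<delta> (w \<otimes> c) \<otimes> x [^] n) \<oplus> (w \<otimes> c) \<otimes> x [^] Suc n"
      unfolding x_times[of "w \<otimes> c", OF DiffD1[OF cw(2)]] nat_pow_Suc2[OF x_closed]
      using uc cc wc pc dcc x_closed by algebra
    finally have xwt: "x \<otimes> (w \<otimes> t) =
      (x \<otimes> (w \<otimes> u) \<oplus> \<delta> (w \<otimes> c) \<otimes> x [^] n) \<oplus> (w \<otimes> c) \<otimes> x [^] Suc n" .
    have "f \<otimes> s = (t \<ominus> a \<otimes> (w \<otimes> t)) \<oplus> x \<otimes> (w \<otimes> t) \<oplus> f \<otimes> j"
      unfolding s_eq t_def[symmetric] f_def using tc ac wc jc x_closed by algebra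
    also have "\<dots> = ((t \<ominus> a \<otimes> (w \<otimes> t)) \<oplus> (x \<otimes> (w \<otimes> u) \<oplus> \<delta> (w \<otimes> c) \<otimes> x [^] n))
      \<oplus> (w \<otimes> c) \<otimes> x [^] Suc n \<oplus> f \<otimes> j"
      unfolding xwt using tc uc ac wc jc cc dcc pc fc x_closed by algebra
    finally have fs: "f \<otimes> s =
      ((t \<ominus> a \<otimes> (w \<otimes> t)) \<oplus> (x \<otimes> (w \<otimes> u) \<oplus> \<delta> (w \<otimes> c) \<otimes> x [^] n))
      \<oplus> (w \<otimes> c) \<otimes> x [^] Suc n \<oplus> f \<otimes> j" .
    have "i \<oplus> f \<otimes> s \<noteq> \<one>"
      unfolding fs
    proof (rule no_one)
      show "(t \<ominus> a \<otimes> (w \<otimes> t)) \<oplus> (x \<otimes> (w \<otimes> u) \<oplus> \<delta> (w \<otimes> c) \<otimes> x [^] n) \<in> polys R (Suc n)"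
        using t u a w(1) dc
        by (intro polys_add polys_minus polys_lmult polys_x_l polys_monom RR)
      show "f \<otimes> j \<in> ext_ideal ?P" using j fc I.I_l_closed by blast
    qed (rule cw)
    with left show ?thesis by blast
  qed
  then show "i \<oplus> s \<otimes> f \<noteq> \<one>" "i \<oplus> f \<otimes> s \<noteq> \<one>" by blast+
qed

section \<open>Quasi-duo implies commutativity modulo the radical\<close>

lemma subset_ext_ideal: "P \<subseteq> R \<Longrightarrow> P \<subseteq> ext_ideal P"
  using polys_SucI[of \<zero> P 0] by (fastforce intro: ext_idealI[of _ _ 1] simp del: polys.simps(2))

text \<open>The family \<open>F\<close> stands for the maximal left or the maximal right ideals, so
  both cases share one argument. Replacing \<open>x\<close> by x - a keeps the commutator with
  \<open>b\<close> in \<open>R\<close>, where \<open>ext\<close> can be applied to it.\<close>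

lemma perturbed_derivation_mem:
  assumes prime: "\<And>M. M \<in> F \<Longrightarrow> completely_prime M S"
    and ext: "\<And>M w a. M \<in> F \<Longrightarrow> w \<in> R - M \<Longrightarrow> a \<in> R \<Longrightarrow>
      \<exists>M'\<in>F. M \<inter> R \<subseteq> M' \<and> \<one> \<oplus> (x \<ominus> a) \<otimes> w \<in> M'"
    and M: "M \<in> F" and a: "a \<in> R" and b: "b \<in> R"
  shows "\<delta> b \<ominus> (a \<otimes> b \<ominus> b \<otimes> a) \<in> M"
proof (rule ccontr)
  let ?y = "x \<ominus> a"
  define z where "z = ?y \<otimes> b \<ominus> b \<otimes> ?y"
  note carr = R_carrier[OF a] R_carrier[OF b] R_carrier[OF \<delta>_closed[OF b]]
  have "z = x \<otimes> b \<ominus> b \<otimes> x \<ominus> (a \<otimes> b \<ominus> b \<otimes> a)"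
    unfolding z_def using carr x_closed by algebra
  also have "\<dots> = \<delta> b \<ominus> (a \<otimes> b \<ominus> b \<otimes> a)"
    unfolding x_times[OF b] using carr x_closed by algebra
  finally have z: "z = \<delta> b \<ominus> (a \<otimes> b \<ominus> b \<otimes> a)" .
  have zR: "z \<in> R"
    unfolding z using R_subring(5-7) a b \<delta>_closed by (simp add: a_minus_def)
  have y: "?y \<in> carrier S" and zc: "z \<in> carrier S"
    using carr zR by auto
  assume "\<delta> b \<ominus> (a \<otimes> b \<ominus> b \<otimes> a) \<notin> M"
  then have "z \<in> R - M" using z zR by simp
  then obtain M' where M': "M' \<in> F" "\<one> \<oplus> ?y \<otimes> z \<in> M'"
    using ext[OF M _ a] by blast
  \<comment> \<open>Passing to a new ideal may enlarge the trace on \<open>R\<close>, so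
    nonmembership is not inherited; it is recovered from 1 = (1 + yw) - yw.\<close>
  have unit: "w \<notin> N" if "N \<in> F" "w \<in> R" "\<one> \<oplus> ?y \<otimes> w \<in> N" for N w
  proof
    interpret ideal N S using prime[OF that(1)] by (simp add: completely_prime_def)
    assume "w \<in> N"
    then have "(\<one> \<oplus> ?y \<otimes> w) \<ominus> ?y \<otimes> w \<in> N"
      using that(3) I_l_closed[OF _ y] by (simp add: a_minus_def)
    moreover have "(\<one> \<oplus> ?y \<otimes> w) \<ominus> ?y \<otimes> w = \<one>"
      using y R_carrier[OF that(2)] by algebra
    ultimately show False
      using prime[OF that(1)] by (simp add: completely_prime_def)
  qed
  have zM': "z \<notin> M'" using unit[OF M'(1) zR M'(2)] .
  have e: "z \<otimes> z \<otimes> z \<ominus> (z \<otimes> b \<ominus> b \<otimes> z) \<in> M'"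
    using conjugated_commutator_mem[OF prime[OF M'(1)] y zc carr(2) zM' M'(2)]
    unfolding z_def[symmetric] .
  \<comment> \<open>The relation must lie in \<open>R\<close>, because only M' \<inter> R is known
    to be contained in the next ideal \<open>N\<close>.\<close>
  have eR: "z \<otimes> z \<otimes> z \<ominus> (z \<otimes> b \<ominus> b \<otimes> z) \<in> R"
    using R_subring(5-7) b zR by (simp add: a_minus_def)
  have zz: "z \<otimes> z \<in> R - M'"
    using completely_prime_mult[OF prime[OF M'(1)] zc zc zM' zM'] zR R_subring(6) by simp
  then obtain N where N: "N \<in> F" "M' \<inter> R \<subseteq> N" "\<one> \<oplus> ?y \<otimes> (z \<otimes> z) \<in> N"
    using ext[OF M'(1) _ a] by blast
  have "z \<otimes> z \<notin> N" using unit[OF N(1) _ N(3)] zz by blast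
  moreover have "ideal N S" using prime[OF N(1)] by (simp add: completely_prime_def)
  ultimately have "z \<notin> N"
    using ideal.I_l_closed[of N S z z] zc by blast
  then show False
    using no_compatible_completely_prime[OF prime[OF N(1)] y carr(2) z_def _ N(3)] e eR N(2) by blast
qed

text \<open>With P = M \<inter> R, the left ideal P[x] + Sf is proper because i + sf is never 1.
  This supplies \<open>ext\<close> for the maximal left ideals.\<close>

lemma linear_mem_maximal_left:
  assumes "completely_prime M S" "w \<in> R - M" "a \<in> R"
  shows "\<exists>M'. maximal_left_ideal M' S \<and> M \<inter> R \<subseteq> M' \<and> \<one> \<oplus> (x \<ominus> a) \<otimes> w \<in> M'"
proof -
  let ?I = "ext_ideal (M \<inter> R)" and ?f = "\<one> \<oplus> (x \<ominus> a) \<otimes> w"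
  have "ideal ?I S"
    using assms(1) by (simp add: completely_prime_def diff_ideal_contraction ideal_ext_ideal)
  then have I: "left_ideal ?I S"
    by (simp add: ideal_iff_left_right)
  have f: "?f \<in> carrier S" using assms by simp
  note K = left_ideal_add_principal[OF I f]
  have "\<one> \<notin> {i \<oplus> s \<otimes> ?f | i s. i \<in> ?I \<and> s \<in> carrier S}"
    using linear_not_invertible_mod_ext_ideal(1)[OF assms(1) _ _ assms(3)] assms(2) by fastforce
  then obtain M' where "maximal_left_ideal M' S"
    "{i \<oplus> s \<otimes> ?f | i s. i \<in> ?I \<and> s \<in> carrier S} \<subseteq> M'"
    using exists_maximal_left_ideal[OF K(1)] by blast
  then show ?thesis
    using K(2,3) subset_ext_ideal[of "M \<inter> R"] by blast
qed

text \<open>The same element f serves for P[x] + fS, now excluding i + fs = 1, so the relation fed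
  into \<open>perturbed_derivation_mem\<close> does not depend on the side.\<close>

lemma linear_mem_maximal_right:
  assumes "completely_prime M S" "w \<in> R - M" "a \<in> R"
  shows "\<exists>M'. maximal_right_ideal M' S \<and> M \<inter> R \<subseteq> M' \<and> \<one> \<oplus> (x \<ominus> a) \<otimes> w \<in> M'"
proof -
  interpret opp: ring "opposite S" by (rule ring_opposite) (rule ring_axioms)
  let ?I = "ext_ideal (M \<inter> R)" and ?f = "\<one> \<oplus> (x \<ominus> a) \<otimes> w"
  have "ideal ?I S"
    using assms(1) by (simp add: completely_prime_def diff_ideal_contraction ideal_ext_ideal)
  then have I: "left_ideal ?I (opposite S)"
    by (simp add: ideal_iff_left_right)
  have f: "?f \<in> carrier (opposite S)" using assms by simp
  note K = opp.left_ideal_add_principal[OF I f, simplified]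
  have "\<one> \<notin> {i \<oplus> ?f \<otimes> s | i s. i \<in> ?I \<and> s \<in> carrier S}"
    using linear_not_invertible_mod_ext_ideal(2)[OF assms(1) _ _ assms(3)] assms(2) by fastforce
  then obtain M' where "maximal_right_ideal M' S"
    "{i \<oplus> ?f \<otimes> s | i s. i \<in> ?I \<and> s \<in> carrier S} \<subseteq> M'"
    using opp.exists_maximal_left_ideal[simplified, OF K(1)] by blast
  then show ?thesis
    using K(2,3) subset_ext_ideal[of "M \<inter> R"] by blast
qed

lemma perturbed_derivation_mem_jacobson:
  assumes qd: "left_quasi_duo S \<or> right_quasi_duo S" and ab: "a \<in> R" "b \<in> R"
  shows "\<delta> b \<ominus> (a \<otimes> b \<ominus> b \<otimes> a) \<in> jacobson S"
  using qd
proof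
  have carr: "\<delta> b \<ominus> (a \<otimes> b \<ominus> b \<otimes> a) \<in> carrier S"
    using ab \<delta>_closed by simp
  {
    assume "left_quasi_duo S"
    then have prime: "completely_prime M S" if "maximal_left_ideal M S" for M
      using that completely_prime_if_maximal_left by (simp add: left_quasi_duo_def)
    have "\<delta> b \<ominus> (a \<otimes> b \<ominus> b \<otimes> a) \<in> M" if "maximal_left_ideal M S" for M
      by (rule perturbed_derivation_mem[of "{M. maximal_left_ideal M S}"])
        (use that ab prime linear_mem_maximal_left in auto)
    then show ?thesis
      using carr by (simp add: jacobson_def)
  next
    interpret opp: ring "opposite S" by (rule ring_opposite) (rule ring_axioms)
    assume "right_quasi_duo S"
    then have prime: "completely_prime M S" if "maximal_right_ideal M S" for M
      using that opp.completely_prime_if_maximal_left[of M] ideal_opposite completely_prime_opposite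
      by (simp add: right_quasi_duo_def)
    have "\<delta> b \<ominus> (a \<otimes> b \<ominus> b \<otimes> a) \<in> M" if "maximal_right_ideal M S" for M
      by (rule perturbed_derivation_mem[of "{M. maximal_right_ideal M S}"])
        (use that ab prime linear_mem_maximal_right in auto)
    then show ?thesis
      using carr by (simp add: jacobson_eq_maximal_right)
  }
qed

lemma commutative_mod_jacobson_if_quasi_duo:
  assumes "left_quasi_duo S \<or> right_quasi_duo S" and ab: "a \<in> R" "b \<in> R"
  shows "\<delta> b \<in> jacobson S" and "a \<otimes> b \<ominus> b \<otimes> a \<in> jacobson S"
proof -
  interpret J: ideal "jacobson S" S by (rule ideal_jacobson)
  note carr = R_carrier[OF ab(1)] R_carrier[OF ab(2)] R_carrier[OF \<delta>_closed[OF ab(2)]]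
  \<comment> \<open>The choice a = 0 isolates the derivation; general \<open>a\<close> then yields
    the commutator by subtraction.\<close>
  show d: "\<delta> b \<in> jacobson S"
    using perturbed_derivation_mem_jacobson[OF assms(1) R_subring(2) ab(2)] carr
    by (simp add: a_minus_def)
  have "\<delta> b \<ominus> (\<delta> b \<ominus> (a \<otimes> b \<ominus> b \<otimes> a)) \<in> jacobson S"
    using d perturbed_derivation_mem_jacobson[OF assms] by (simp add: a_minus_def)
  moreover have "\<delta> b \<ominus> (\<delta> b \<ominus> (a \<otimes> b \<ominus> b \<otimes> a)) = a \<otimes> b \<ominus> b \<otimes> a"
    using carr by algebra
  ultimately show "a \<otimes> b \<ominus> b \<otimes> a \<in> jacobson S" by simp
qed

section \<open>Commutativity modulo an ideal from generators\<close>

lemma commutator_mem_if_generators: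
  assumes J: "ideal J S" and t: "t \<in> carrier S"
    and r: "\<And>r. r \<in> R \<Longrightarrow> r \<otimes> t \<ominus> t \<otimes> r \<in> J" and x: "x \<otimes> t \<ominus> t \<otimes> x \<in> J"
    and s: "s \<in> carrier S"
  shows "s \<otimes> t \<ominus> t \<otimes> s \<in> J"
proof -
  interpret J: ideal J S by fact
  \<comment> \<open>By [ab,t] = a[b,t] + [a,t]b, the elements commuting with \<open>t\<close> modulo
    \<open>J\<close> are closed under products, so it suffices to test \<open>R\<close> and
    \<open>x\<close>.\<close>
  have leibniz: "a \<otimes> b \<otimes> t \<ominus> t \<otimes> (a \<otimes> b) \<in> J"
    if "a \<in> carrier S" "b \<in> carrier S" "a \<otimes> t \<ominus> t \<otimes> a \<in> J" "b \<otimes> t \<ominus> t \<otimes> b \<in> J" for a b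
  proof -
    have "a \<otimes> (b \<otimes> t \<ominus> t \<otimes> b) \<oplus> (a \<otimes> t \<ominus> t \<otimes> a) \<otimes> b \<in> J"
      using that J.I_l_closed J.I_r_closed by simp
    moreover have "a \<otimes> (b \<otimes> t \<ominus> t \<otimes> b) \<oplus> (a \<otimes> t \<ominus> t \<otimes> a) \<otimes> b = a \<otimes> b \<otimes> t \<ominus> t \<otimes> (a \<otimes> b)"
      using that(1,2) t by algebra
    ultimately show ?thesis by simp
  qed
  have pow: "x [^] n \<otimes> t \<ominus> t \<otimes> x [^] n \<in> J" for n :: nat
  proof (induction n)
    case 0
    have "\<one> \<otimes> t \<ominus> t \<otimes> \<one> = \<zero>" using t by (simp add: a_minus_def r_neg)
    then show ?case by simp
  next
    case (Suc n)
    then show ?case using leibniz[OF _ x_closed _ x] by simp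
  qed
  have "s \<otimes> t \<ominus> t \<otimes> s \<in> J" if "s \<in> polys R n" for n
    using that
  proof (induction n arbitrary: s)
    case 0
    then show ?case using t by (simp add: a_minus_def)
  next
    case (Suc n)
    then obtain v p where v: "v \<in> polys R n" "p \<in> R" "s = v \<oplus> p \<otimes> x [^] n" by auto
    have carr: "v \<in> carrier S" "p \<otimes> x [^] n \<in> carrier S"
      using polys_carrier[OF diff_ideal_R v(1)] v(2) by simp_all
    have "(v \<otimes> t \<ominus> t \<otimes> v) \<oplus> (p \<otimes> x [^] n \<otimes> t \<ominus> t \<otimes> (p \<otimes> x [^] n)) \<in> J"
      using Suc.IH[OF v(1)] leibniz[OF _ _ r[OF v(2)] pow] v(2) by simp
    moreover have "s \<otimes> t \<ominus> t \<otimes> s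
      = (v \<otimes> t \<ominus> t \<otimes> v) \<oplus> (p \<otimes> x [^] n \<otimes> t \<ominus> t \<otimes> (p \<otimes> x [^] n))"
      unfolding v(3) using carr t by (simp add: l_distr r_distr a_minus_def minus_add a_ac)
    ultimately show ?case by simp
  qed
  then show ?thesis
    using carrier_eq_polys[OF s] by blast
qed

text \<open>The generator test is used three times: against a fixed element of \<open>R\<close>,
  against \<open>x\<close>, and finally against arbitrary \<open>t\<close>, the first two supplying
  the input of the third. The mixed commutators are [x,r] = \<delta>(r).\<close>

lemma commutator_mem:
  assumes J: "ideal J S"
    and comm: "\<And>a b. a \<in> R \<Longrightarrow> b \<in> R \<Longrightarrow> a \<otimes> b \<ominus> b \<otimes> a \<in> J"
    and \<delta>: "\<And>r. r \<in> R \<Longrightarrow> \<delta> r \<in> J"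
    and st: "s \<in> carrier S" "t \<in> carrier S"
  shows "s \<otimes> t \<ominus> t \<otimes> s \<in> J"
proof -
  interpret J: ideal J S by fact
  have swap: "a \<otimes> b \<ominus> b \<otimes> a \<in> J"
    if "a \<in> carrier S" "b \<in> carrier S" "b \<otimes> a \<ominus> a \<otimes> b \<in> J" for a b
  proof -
    have "a \<otimes> b \<ominus> b \<otimes> a = \<ominus> (b \<otimes> a \<ominus> a \<otimes> b)" using that(1,2) by algebra
    then show ?thesis using that(3) by simp
  qed
  have x: "x \<otimes> r \<ominus> r \<otimes> x \<in> J" if "r \<in> R" for r
  proof -
    have "x \<otimes> r \<ominus> r \<otimes> x = \<delta> r"
      unfolding x_times[OF that] using R_carrier[OF that] R_carrier[OF \<delta>_closed[OF that]] x_closed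
      by algebra
    then show ?thesis using \<delta>[OF that] by simp
  qed
  have with_R: "u \<otimes> r \<ominus> r \<otimes> u \<in> J" if "u \<in> carrier S" "r \<in> R" for u r
    by (rule commutator_mem_if_generators[OF J]) (use that comm x in auto)
  have with_x: "u \<otimes> x \<ominus> x \<otimes> u \<in> J" if "u \<in> carrier S" for u
  proof (rule commutator_mem_if_generators[OF J])
    show "x \<otimes> x \<ominus> x \<otimes> x \<in> J" by (simp add: a_minus_def r_neg)
  qed (use that x swap in auto)
  show ?thesis
    by (rule commutator_mem_if_generators[OF J]) (use st with_R with_x swap in auto)
qed

end

text \<open>Since st = (st - ts) + ts, the products st and ts lie in \<open>I\<close>
  together.\<close>

lemma (in ring) one_sided_ideal_above_commutators:
  assumes comm: "\<And>s t. s \<in> carrier R \<Longrightarrow> t \<in> carrier R \<Longrightarrow> s \<otimes> t \<ominus> t \<otimes> s \<in> J"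
    and I: "left_ideal I R \<or> right_ideal I R" and J: "J \<subseteq> I"
  shows "ideal I R"
proof -
  interpret additive_subgroup I R
    using I by (auto simp: left_ideal_def right_ideal_def)
  have swap: "s \<otimes> t \<in> I" if "s \<in> carrier R" "t \<in> carrier R" "t \<otimes> s \<in> I" for s t
  proof -
    have "(s \<otimes> t \<ominus> t \<otimes> s) \<oplus> t \<otimes> s \<in> I"
      using comm[OF that(1,2)] J that(3) by blast
    moreover have "(s \<otimes> t \<ominus> t \<otimes> s) \<oplus> t \<otimes> s = s \<otimes> t"
      using that(1,2) by algebra
    ultimately show ?thesis by simp
  qed
  show ?thesis
    unfolding ideal_iff_left_right
    using I swap a_Hcarr unfolding left_ideal_def right_ideal_def by blast
qed

section \<open>The five equivalent conditions\<close>

theorem theorem1p1: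
  fixes S :: "('a, 'b) ring_scheme" and R :: "'a set" and \<delta> :: "'a \<Rightarrow> 'a" and x :: 'a
  assumes "is_diff_poly_ring S R \<delta> x"
  defines "J0 \<equiv> jacobson S \<inter> R"
  shows "(left_quasi_duo S \<longleftrightarrow> right_quasi_duo S)
       \<and> (right_quasi_duo S \<longleftrightarrow>
            (\<forall>I. left_ideal I S \<and> jacobson S \<subseteq> I \<longrightarrow> ideal I S))
       \<and> ((\<forall>I. left_ideal I S \<and> jacobson S \<subseteq> I \<longrightarrow> ideal I S) \<longleftrightarrow>
            (\<forall>I. right_ideal I S \<and> jacobson S \<subseteq> I \<longrightarrow> ideal I S))
       \<and> ((\<forall>I. right_ideal I S \<and> jacobson S \<subseteq> I \<longrightarrow> ideal I S) \<longleftrightarrow>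
            ((\<forall>a\<in>R. \<forall>b\<in>R. a \<otimes>\<^bsub>S\<^esub> b \<ominus>\<^bsub>S\<^esub> b \<otimes>\<^bsub>S\<^esub> a \<in> J0) \<and> \<delta> ` R \<subseteq> J0))"
    (is "(?LQ \<longleftrightarrow> ?RQ) \<and> (?RQ \<longleftrightarrow> ?LD) \<and> (?LD \<longleftrightarrow> ?RD) \<and> (?RD \<longleftrightarrow> ?C)")
proof -
  interpret differential_polynomial_ring S R \<delta> x
    by unfold_locales fact
  \<comment> \<open>Every maximal left ideal contains the radical, so it is among the ideals covered
    by \<open>?LD\<close>.\<close>
  have "?LQ" if ?LD
    using that unfolding left_quasi_duo_def
    by (auto simp: maximal_left_ideal_def jacobson_def)
  moreover have "?RQ" if ?RD
    using that unfolding right_quasi_duo_def jacobson_eq_maximal_right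
    by (auto simp: maximal_right_ideal_def)
  \<comment> \<open>The passage between left and right: either quasi-duo condition gives
    \<open>?C\<close>, and the symmetric condition \<open>?C\<close> gives both duo
    conditions.\<close>
  moreover have "?C" if "?LQ \<or> ?RQ"
    using commutative_mod_jacobson_if_quasi_duo[OF that] R_subring \<delta>_closed
    by (auto simp: J0_def a_minus_def)
  moreover have "?LD \<and> ?RD" if C: ?C
  proof -
    have "s \<otimes>\<^bsub>S\<^esub> t \<ominus>\<^bsub>S\<^esub> t \<otimes>\<^bsub>S\<^esub> s \<in> jacobson S" if "s \<in> carrier S" "t \<in> carrier S" for s t
      by (rule commutator_mem[OF ideal_jacobson]) (use C that in \<open>auto simp: J0_def\<close>)
    then show ?thesis
      using one_sided_ideal_above_commutators[of "jacobson S"] by blast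
  qed
  ultimately show ?thesis by blast
qed

end
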